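(* Let $H$, $A$, $b$, $(b_k)$ be as in the context, and assume $b_k\simeq1$. Let $R>0$, and consider one of the following situations: (a) the system $y_t+iAy=bu$, where $A$ is positive and its eigenvalues $(\lambda_n)_{n\ge1}$ form a regular increasing sequence of strictly positive numbers with $\lambda_n=Rn^\alpha+O(n^{\alpha-1})$ as $n\to\infty$, for some $\alpha\ge2$; (b) the system $y_t+Ay=bu$, where $A$ is positive and its eigenvalues $(\lambda_n)_{n\ge1}$ form a regular increasing sequence of strictly positive numbers with $\lambda_n=Rn^\alpha+O(n^{\alpha-1})$ as $n\to\infty$, for some $\alpha>1$; (c) the system $y_t+iAy=bu$, where $A$ is not necessarily positive and its eigenvalues $(\lambda_n)_{n\in\mathbb Z^*}$ form a regular increasing sequence of nonzero numbers with $\lambda_n=Rn^\alpha+O(n^{\alpha-1})$ and $\lambda_{-n}=-Rn^\alpha+O(n^{\alpha-1})$ as $n\to+\infty$, for some $\alpha>1$, and $\operatorname{sgn}(\lambda_n)=\operatorname{sgn}(n)$ for all $n\in\mathbb Z^*$. Then the power of $1/T$ in the exponential upper bound $e^{K/(RT)^{1/(\alpha-1)}}$ for the cost of the control is optimal, in the sense that there exist constants $C>0$ and $c>0$, independent of $T$ ($c$ may depend on $\alpha$), such that $$c\,e^{C/T^{1/(\alpha-1)}}\le C_T\qquad\text{for all }T\in(0,1),$$ where $C_T$ is the cost of the control of the system considered.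
   Context: $H$ is a Hilbert space, $A:\mathcal D(A)\to H$ is a self-adjoint operator with compact resolvent with nonzero eigenvalues $(\lambda_n)$ (indexed by $n\ge1$ or by $\mathbb Z^*=\mathbb Z\setminus\{0\}$), and $(e_n)$ is a corresponding orthonormal basis of eigenvectors of $H$. $\mathcal D(A)'$ is the dual of $\mathcal D(A)$ with pivot space $H$, normed by $\|x\|_{\mathcal D(A)'}^2=\sum_k \langle x,e_k\rangle^2/\lambda_k^2$. The control space $U$ is $\mathbb R$ or $\mathbb C$, $b\in\mathcal D(A)'$ is fixed, and $b_k:=\langle b,e_k\rangle_{(\mathcal D(A)',\mathcal D(A))}$. The notation $b_k\simeq 1$ means that $(|b_k|)$ is bounded above and below by strictly positive constants. A family of real numbers $(\lambda_n)_{n\in\mathcal C}$ ($\mathcal C$ countable) is regular if $\inf_{m\ne n}|\lambda_m-\lambda_n|>0$. For $y^0\in H$ and $u\in L^2((0,T),U)$, the system $y_t+Ay=bu$ (respectively $y_t+iAy=bu$) with $y(0)=y^0$ has a unique mild solution $y\in C^0([0,T],H)$; its coordinates $y_k=\langle y,e_k\rangle$ solve $y_k'=-\lambda_k y_k+b_ku$ (respectively $y_k'=-i\lambda_k y_k+b_ku$). A control $u$ drives $y^0$ to $0$ at time $T$ if $y(T)=0$. Times are always assumed small, for example $T\in(0,1)$. The paper states that in each of these situations the system is null controllable (every $y^0\in H$ can be driven to $0$ at time $T$ by some $u\in L^2((0,T),U)$), with $C_T$ bounded above by a constant times $e^{K/(RT)^{1/(\alpha-1)}}$ for suitable $K>0$.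 The cost of the control $C_T$ is the smallest constant $C>0$ such that for every $y^0\in H$ there is a control $u$ driving $y^0$ to $0$ at time $T$ with $\|u\|_{L^2((0,T),U)}\le C\|y^0\|_H$. *)

theory Defs
  imports "HOL-Analysis.Analysis" "HOL-Library.Landau_Symbols"
begin

text \<open>
  The scalars are \<open>\<real>\<close> or \<open>\<complex>\<close>: an instance is, through \<open>to_complex\<close>, a subfield of
  \<open>\<complex>\<close> which contains \<open>\<real>\<close>, hence one of these two.
\<close>

class real_or_complex = real_normed_field + banach + second_countable_topology +
  fixes to_complex :: "'a \<Rightarrow> complex"
    and conjugate :: "'a \<Rightarrow> 'a"
  assumes to_complex_add: "to_complex (x + y) = to_complex x + to_complex y"
    and to_complex_mult: "to_complex (x * y) = to_complex x * to_complex y"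
    and to_complex_scaleR_one: "to_complex (r *\<^sub>R 1) = of_real r"
    and norm_to_complex: "norm (to_complex x) = norm x"
    and to_complex_conjugate: "to_complex (conjugate x) = cnj (to_complex x)"

instantiation real :: real_or_complex
begin
definition to_complex_real :: "real \<Rightarrow> complex" where "to_complex_real x = of_real x"
definition conjugate_real :: "real \<Rightarrow> real" where "conjugate_real x = x"
instance
proof
  fix x y r :: real
  show "to_complex (x + y) = to_complex x + to_complex y"
    by (simp only: to_complex_real_def of_real_add)
  show "to_complex (x * y) = to_complex x * to_complex y"
    by (simp only: to_complex_real_def of_real_mult)
  show "to_complex (r *\<^sub>R (1::real)) = of_real r"
    by (simp only: to_complex_real_def real_scaleR_def mult_1_right)
  show "norm (to_complex x) = norm x"
    by (simp only: to_complex_real_def norm_of_real real_norm_def)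
  show "to_complex (conjugate x) = cnj (to_complex x)"
    by (simp only: to_complex_real_def conjugate_real_def complex_cnj_complex_of_real)
qed
end

instantiation complex :: real_or_complex
begin
definition to_complex_complex :: "complex \<Rightarrow> complex" where "to_complex_complex z = z"
definition conjugate_complex :: "complex \<Rightarrow> complex" where "conjugate_complex z = cnj z"
instance
proof
  fix x y :: complex and r :: real
  show "to_complex (x + y) = to_complex x + to_complex y"
    and "to_complex (x * y) = to_complex x * to_complex y"
    and "norm (to_complex x) = norm x"
    and "to_complex (conjugate x) = cnj (to_complex x)"
    by (simp_all only: to_complex_complex_def conjugate_complex_def)
  show "to_complex (r *\<^sub>R (1::complex)) = of_real r"
    by (simp only: to_complex_complex_def of_real_def)
qed
end

text \<open>
  Real or complex Hilbert spaces; the inner product is linear in its first argument.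
  Completeness is part of the class \<^class>\<open>banach\<close>.
\<close>

locale hilbert_space = vector_space scale
  for scale :: "'k::real_or_complex \<Rightarrow> 'h::banach \<Rightarrow> 'h"  (infixr \<open>*\<^sub>K\<close> 75) +
  fixes ip :: "'h \<Rightarrow> 'h \<Rightarrow> 'k"
  assumes scale_of_real: "of_real r *\<^sub>K x = r *\<^sub>R x"
    and ip_add_left: "ip (x + y) z = ip x z + ip y z"
    and ip_scale_left: "ip (c *\<^sub>K x) y = c * ip x y"
    and ip_conjugate: "ip y x = conjugate (ip x y)"
    and ip_self: "ip x x = of_real ((norm x)\<^sup>2)"
begin

text \<open>
  An unbounded operator is given by its domain \<open>D\<close> and a function \<open>A\<close> whose values
  outside \<open>D\<close> are irrelevant. The last clause says that the graphs of the adjoint and of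
  the operator coincide, domains included.
\<close>

definition self_adjoint :: "'h set \<Rightarrow> ('h \<Rightarrow> 'h) \<Rightarrow> bool" where
  "self_adjoint D A \<longleftrightarrow>
     subspace D \<and> closure D = UNIV \<and>
     (\<forall>x\<in>D. \<forall>y\<in>D. A (x + y) = A x + A y) \<and>
     (\<forall>c. \<forall>x\<in>D. A (c *\<^sub>K x) = c *\<^sub>K A x) \<and>
     {(y, z). \<forall>x\<in>D. ip (A x) y = ip x z} = {(y, A y) | y. y \<in> D}"

definition positive :: "'h set \<Rightarrow> ('h \<Rightarrow> 'h) \<Rightarrow> bool" where
  "positive D A \<longleftrightarrow> (\<forall>x\<in>D. 0 \<le> Re (to_complex (ip (A x) x)))"

definition compact_resolvent :: "'h set \<Rightarrow> ('h \<Rightarrow> 'h) \<Rightarrow> bool" where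
  "compact_resolvent D A \<longleftrightarrow>
     (\<exists>\<mu>. bij_betw (\<lambda>x. A x - \<mu> *\<^sub>K x) D UNIV \<and>
          compact (closure (inv_into D (\<lambda>x. A x - \<mu> *\<^sub>K x) ` cball 0 1)))"

definition orthonormal_basis :: "'i set \<Rightarrow> ('i \<Rightarrow> 'h) \<Rightarrow> bool" where
  "orthonormal_basis I e \<longleftrightarrow>
     (\<forall>m\<in>I. \<forall>n\<in>I. ip (e m) (e n) = (if m = n then 1 else 0)) \<and>
     closure (span (e ` I)) = UNIV"

text \<open>
  The elements of \<open>D(A)'\<close> (with pivot space \<open>H\<close>) are the conjugate-linear functionals on \<open>D(A)\<close>
  which are continuous for the graph norm, an element \<open>x\<close> of \<open>H\<close> being identified
  with \<open>ip x\<close>. Thus \<open>b \<phi>\<close> is the duality bracket of \<open>b\<close> and \<open>\<phi>\<close>.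
\<close>

definition dual_domain :: "'h set \<Rightarrow> ('h \<Rightarrow> 'h) \<Rightarrow> ('h \<Rightarrow> 'k) set" where
  "dual_domain D A = {b.
     (\<forall>\<phi>\<in>D. \<forall>\<psi>\<in>D. b (\<phi> + \<psi>) = b \<phi> + b \<psi>) \<and>
     (\<forall>c. \<forall>\<phi>\<in>D. b (c *\<^sub>K \<phi>) = conjugate c * b \<phi>) \<and>
     (\<exists>M. \<forall>\<phi>\<in>D. norm (b \<phi>) \<le> M * (norm \<phi> + norm (A \<phi>)))}"

end

definition L2_controls :: "real \<Rightarrow> 'k::real_or_complex set \<Rightarrow> (real \<Rightarrow> 'k) set" where
  "L2_controls T U = {u. set_borel_measurable lborel {0<..<T} u \<and>
     set_integrable lborel {0<..<T} (\<lambda>t. (norm (u t))\<^sup>2) \<and> (\<forall>t\<in>{0<..<T}. u t \<in> U)}"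

definition L2_norm :: "real \<Rightarrow> (real \<Rightarrow> 'k::real_or_complex) \<Rightarrow> real" where
  "L2_norm T u = sqrt (LINT t:{0<..<T}|lborel. (norm (u t))\<^sup>2)"

locale control_system = hilbert_space scale ip
  for scale :: "'k::real_or_complex \<Rightarrow> 'h::banach \<Rightarrow> 'h"  (infixr \<open>*\<^sub>K\<close> 75)
    and ip :: "'h \<Rightarrow> 'h \<Rightarrow> 'k" +
  fixes D :: "'h set" and A :: "'h \<Rightarrow> 'h"
    and I :: "'i set" and lam :: "'i \<Rightarrow> real" and e :: "'i \<Rightarrow> 'h"
    and b :: "'h \<Rightarrow> 'k"
  assumes self_adjoint_A: "self_adjoint D A"
    and compact_resolvent_A: "compact_resolvent D A"
    and basis: "orthonormal_basis I e"
    and eigenvector: "n \<in> I \<Longrightarrow> e n \<in> D \<and> A (e n) = of_real (lam n) *\<^sub>K e n"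
    and eigenvalue_nonzero: "n \<in> I \<Longrightarrow> lam n \<noteq> 0"
    and b_dual: "b \<in> dual_domain D A"
begin

text \<open>
  The operator \<open>exp(- t \<theta> A)\<close> for \<open>t \<ge> 0\<close>, through the spectral decomposition of \<open>A\<close>. Here
  \<open>\<theta> = 1\<close> for \<open>y\<^sub>t + A y = b u\<close> and \<open>\<theta> = \<i>\<close> for \<open>y\<^sub>t + \<i> A y = b u\<close>.
\<close>

definition semigroup_op :: "'k \<Rightarrow> real \<Rightarrow> 'h \<Rightarrow> 'h" where
  "semigroup_op \<theta> t x = (\<Sum>\<^sub>\<infinity>n\<in>I. (exp (- \<theta> * of_real (lam n * t)) * ip x (e n)) *\<^sub>K e n)"

text \<open>
  Duhamel's formula \<open>y(t) = S(t) y\<^sub>0 + \<integral>\<^sub>0\<^sup>t S(t - s) b u(s) ds\<close> is an identity in \<open>D(A)'\<close>, so it is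
  tested against every \<open>\<phi>\<close> in \<open>D(A)\<close>. The extension of \<open>S(\<tau>)\<close> to \<open>D(A)'\<close> is the transpose of the
  adjoint of \<open>S(\<tau>)\<close>, which is the semigroup with \<open>\<theta>\<close> conjugated.
\<close>

definition mild_solution :: "'k \<Rightarrow> real \<Rightarrow> 'h \<Rightarrow> (real \<Rightarrow> 'k) \<Rightarrow> (real \<Rightarrow> 'h) \<Rightarrow> bool" where
  "mild_solution \<theta> T y0 u y \<longleftrightarrow>
     continuous_on {0..T} y \<and>
     (\<forall>t\<in>{0..T}. \<forall>\<phi>\<in>D.
        ip (y t) \<phi> = ip (semigroup_op \<theta> t y0) \<phi> +
          (LINT s:{0<..<t}|lborel. b (semigroup_op (conjugate \<theta>) (t - s) \<phi>) * u s))"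

definition drives_to_zero :: "'k \<Rightarrow> real \<Rightarrow> 'h \<Rightarrow> (real \<Rightarrow> 'k) \<Rightarrow> bool" where
  "drives_to_zero \<theta> T y0 u \<longleftrightarrow> (\<exists>y. mild_solution \<theta> T y0 u y \<and> y T = 0)"

text \<open>The cost is \<open>\<infinity>\<close> if no constant is admissible.\<close>

definition control_cost :: "'k \<Rightarrow> 'k set \<Rightarrow> real \<Rightarrow> ereal" where
  "control_cost \<theta> U T = Inf {ereal C | C. 0 < C \<and>
     (\<forall>y0. \<exists>u\<in>L2_controls T U. drives_to_zero \<theta> T y0 u \<and> L2_norm T u \<le> C * norm y0)}"

end

definition asymp_one :: "'i set \<Rightarrow> ('i \<Rightarrow> 'k::real_normed_vector) \<Rightarrow> bool" where
  "asymp_one I \<beta> \<longleftrightarrow> (\<exists>m>0. \<exists>M>0. \<forall>k\<in>I. m \<le> norm (\<beta> k) \<and> norm (\<beta> k) \<le> M)"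

definition regular_family :: "'i set \<Rightarrow> ('i \<Rightarrow> real) \<Rightarrow> bool" where
  "regular_family I lam \<longleftrightarrow>
     (\<exists>\<gamma>>0. \<forall>m\<in>I. \<forall>n\<in>I. m \<noteq> n \<longrightarrow> \<gamma> \<le> \<bar>lam m - lam n\<bar>)"

definition power_asymptotics :: "real \<Rightarrow> real \<Rightarrow> (nat \<Rightarrow> real) \<Rightarrow> bool" where
  "power_asymptotics R \<alpha> \<mu> \<longleftrightarrow>
     (\<lambda>n. \<mu> n - R * real n powr \<alpha>) \<in> O[sequentially](\<lambda>n. real n powr (\<alpha> - 1))"

end

theory Submission
  imports Defs
begin

text \<open>
  A lower bound for the cost follows by testing one initial state, the first eigenvector, against
  one well chosen combination of finitely many exponentials.

  If \<open>u\<close> drives \<open>e\<^sub>1\<close> to \<open>0\<close> at time \<open>T\<close>, pairing Duhamel's formula with \<open>e\<^sub>k\<close> gives the moments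
  \<open>\<integral>\<^sub>0\<^sup>T exp(- \<theta> \<lambda>\<^sub>k (T - s)) u(s) ds\<close>: they vanish for \<open>k \<noteq> 1\<close>, and the first one is
  \<open>- exp(- \<theta> \<lambda>\<^sub>1 T) / b\<^sub>1\<close> (lemma \<open>moments_of_null_control\<close>). So if \<open>f(t) = \<Sum>\<^sub>k a\<^sub>k exp(- \<theta> \<lambda>\<^sub>k t)\<close>
  is a finite sum, then
  \<open>\<integral>\<^sub>0\<^sup>T f(T - s) u(s) ds = - a\<^sub>1 exp(- \<theta> \<lambda>\<^sub>1 T) / b\<^sub>1\<close>, and the cost is at least of the order of
  \<open>\<bar>a\<^sub>1\<bar> / sup \<bar>f\<bar>\<close>, the supremum being over \<open>[0, T]\<close>
  (lemma \<open>control_cost_ge_flat_exponential_sum\<close>).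

  To make this quotient large, take for \<open>f\<close> the divided difference, up to sign, of
  \<open>z \<mapsto> exp(- t z)\<close> at the points \<open>\<theta> \<lambda>\<^sub>1, \<dots>, \<theta> \<lambda>\<^sub>n\<^sub>+\<^sub>1\<close>. It vanishes to order \<open>n\<close> at
  \<open>t = 0\<close>: \<open>\<bar>f(t)\<bar> \<le> t\<^sup>n / n!\<close>, because the exponentials have modulus at most \<open>1\<close>, while
  \<open>1 / \<bar>a\<^sub>1\<bar> = \<Prod>\<^sub>j (\<lambda>\<^sub>j - \<lambda>\<^sub>1)\<close> (lemma \<open>exists_flat_exponential_sum\<close>). Since
  \<open>0 < \<lambda>\<^sub>j \<le> Q j\<^sup>\<alpha>\<close> for some \<open>Q\<close>, the product is at most \<open>Q\<^sup>n (n + 1)!\<^sup>\<alpha>\<close>. Hence the cost is at least a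
  constant times
  \<open>n! / ((Q T)\<^sup>n (n + 1)!\<^sup>\<alpha>) \<ge> (2\<^sup>\<alpha> Q T n\<^sup>\<alpha>\<^sup>-\<^sup>1)\<^sup>-\<^sup>n\<close>
  for every \<open>n\<close>, and for \<open>n\<close> close to a small multiple of \<open>T\<^sup>-\<^sup>1\<^sup>/\<^sup>(\<^sup>\<alpha>\<^sup>-\<^sup>1\<^sup>)\<close>
  the right-hand side is at least \<open>e\<^sup>n\<close> (lemma \<open>exists_order_with_exponential_gain\<close>).

  The three situations are treated alike: \<open>\<theta>\<close> enters only through
  \<open>\<bar>\<theta>\<bar> = 1\<close> and \<open>0 \<le> Re \<theta> \<le> 1\<close>, and only eigenvalues of positive index are tested.
\<close>

section \<open>The exponential over real or complex scalars\<close>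

lemma bounded_linear_to_complex: "bounded_linear (to_complex :: 'k::real_or_complex \<Rightarrow> complex)"
proof (rule bounded_linear_intro[where K = 1])
  fix x y :: 'k and r :: real
  show "to_complex (x + y) = to_complex x + to_complex y"
    by (rule to_complex_add)
  have "r *\<^sub>R x = (r *\<^sub>R 1) * x" by simp
  then show "to_complex (r *\<^sub>R x) = r *\<^sub>R to_complex x"
    by (metis to_complex_mult to_complex_scaleR_one scaleR_conv_of_real)
  show "norm (to_complex x) \<le> norm x * 1"
    by (simp add: norm_to_complex)
qed

lemmas to_complex_minus = linear_neg[OF bounded_linear.linear[OF bounded_linear_to_complex]]
lemmas to_complex_diff = linear_diff[OF bounded_linear.linear[OF bounded_linear_to_complex]]
lemmas to_complex_scaleR = linear_scale[OF bounded_linear.linear[OF bounded_linear_to_complex]]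

lemma to_complex_one: "to_complex (1 :: 'k::real_or_complex) = 1"
  using to_complex_scaleR_one[of 1, where 'a = 'k] by simp

lemma to_complex_of_real: "to_complex (of_real r :: 'k::real_or_complex) = of_real r"
  by (simp add: of_real_def to_complex_scaleR to_complex_one)

lemma to_complex_eq_iff: "to_complex x = to_complex y \<longleftrightarrow> x = (y :: 'k::real_or_complex)"
  using norm_to_complex[of "x - y"] by (auto simp: to_complex_diff)

lemma to_complex_power: "to_complex (x ^ n) = to_complex (x :: 'k::real_or_complex) ^ n"
  by (induction n) (auto simp: to_complex_one to_complex_mult)

lemma to_complex_exp: "to_complex (exp x) = exp (to_complex (x :: 'k::real_or_complex))"
proof -
  have "to_complex (exp x) = (\<Sum>n. to_complex (x ^ n /\<^sub>R fact n))"
    unfolding exp_def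
    by (rule bounded_linear.suminf[OF bounded_linear_to_complex summable_exp_generic])
  then show ?thesis
    by (simp add: exp_def to_complex_scaleR to_complex_power)
qed

lemma norm_exp_to_complex: "norm (exp x) = exp (Re (to_complex (x :: 'k::real_or_complex)))"
  by (metis norm_to_complex to_complex_exp norm_exp_eq_Re)

text \<open>
  The semigroup with conjugated \<open>\<theta>\<close> acts on test vectors, on which \<open>b\<close> is conjugate-linear;
  the two conjugations cancel.
\<close>

lemma conjugate_exp_conjugate:
  "conjugate (exp (- conjugate \<theta> * of_real r)) = exp (- \<theta> * of_real r :: 'k::real_or_complex)"
  by (simp add: to_complex_eq_iff[symmetric] to_complex_conjugate to_complex_exp to_complex_mult
      to_complex_minus to_complex_of_real exp_cnj)

section \<open>Exponential sums which are flat at the origin\<close>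

text \<open>
  The sum constructed here is \<open>(-1)\<^sup>n\<close> times the divided difference of \<open>z \<mapsto> exp(- t z)\<close> at the points
  \<open>z\<^sub>0, \<dots>, z\<^sub>n\<close>. When a point \<open>w\<close> is added, the new sum \<open>f\<close> is the solution of
  \<open>f' + w f = f\<^sub>n\<close>, \<open>f(0) = 0\<close>, where \<open>f\<^sub>n\<close> is the old one: this divides each old coefficient
  by \<open>w - z\<^sub>k\<close>, and the initial condition fixes the coefficient of \<open>exp(- t w)\<close>. The bound follows by
  integration, since \<open>exp(- t w)\<close> has modulus at most \<open>1\<close>.
\<close>

lemma exists_flat_exponential_sum:
  fixes z :: "nat \<Rightarrow> 'k::{real_normed_field,banach}"
  assumes "inj_on z {..n}"
    and "\<And>k t. k \<le> n \<Longrightarrow> 0 \<le> t \<Longrightarrow> norm (exp (- (t *\<^sub>R z k))) \<le> 1"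
  shows "\<exists>a. norm (a 0) = inverse (\<Prod>j=1..n. norm (z j - z 0)) \<and>
           (\<forall>t\<ge>0. norm (\<Sum>k\<le>n. a k * exp (- (t *\<^sub>R z k))) \<le> t ^ n / fact n)"
  using assms
proof (induction n)
  case 0
  then show ?case
    by (intro exI[of _ "\<lambda>_. 1"]) simp
next
  case (Suc n)
  have inj: "inj_on z {..n}"
    using Suc.prems(1) by (rule inj_on_subset) auto
  obtain a where a0: "norm (a 0) = inverse (\<Prod>j=1..n. norm (z j - z 0))"
    and flat: "\<And>t. 0 \<le> t \<Longrightarrow> norm (\<Sum>k\<le>n. a k * exp (- (t *\<^sub>R z k))) \<le> t ^ n / fact n"
    using Suc.IH[OF inj] Suc.prems(2) by (meson le_SucI)
  define w where "w = z (Suc n)"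
  have w: "w - z k \<noteq> 0" if "k \<le> n" for k
    using Suc.prems(1) that inj_onD[of z "{..Suc n}" "Suc n" k] by (auto simp: w_def)
  define a' where "a' k = (if k \<le> n then a k / (w - z k) else - (\<Sum>j\<le>n. a j / (w - z j)))" for k
  have vanish: "(\<Sum>k\<le>Suc n. a' k) = 0"
    by (simp add: a'_def)
  have split: "exp (- (x *\<^sub>R w)) * exp (s *\<^sub>R (w - z k))
      = exp (- ((x - s) *\<^sub>R w)) * exp (- (s *\<^sub>R z k))" for x s k
    by (simp add: exp_add[symmetric] algebra_simps)
  have "norm (\<Sum>k\<le>Suc n. a' k * exp (- (t *\<^sub>R z k))) \<le> t ^ Suc n / fact (Suc n)" if t: "0 < t" for t
  proof -
    \<comment> \<open>Variation of constants: \<open>h s\<close> is \<open>exp(- (t - s) w) f(s)\<close> for the new sum \<open>f\<close>, so \<open>h t = f(t)\<close>.\<close>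
    define h where "h s = exp (- (t *\<^sub>R w)) * (\<Sum>k\<le>Suc n. a' k * exp (s *\<^sub>R (w - z k)))" for s
    define h' where "h' s = exp (- (t *\<^sub>R w)) *
        (\<Sum>k\<le>Suc n. a' k * (exp (s *\<^sub>R (w - z k)) * (w - z k)))" for s
    have h': "(h has_vector_derivative h' s) (at s within S)" for s S
      unfolding h_def h'_def
      by (intro has_vector_derivative_mult_right has_vector_derivative_sum
          exp_scaleR_has_vector_derivative_right)
    have h'_eq: "h' s = exp (- ((t - s) *\<^sub>R w)) * (\<Sum>k\<le>n. a k * exp (- (s *\<^sub>R z k)))" for s
    proof -
      have "h' s = (\<Sum>k\<le>n. a k * (exp (- (t *\<^sub>R w)) * exp (s *\<^sub>R (w - z k))))"
        unfolding h'_def sum_distrib_left using w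
        by (simp add: a'_def w_def[symmetric] sum_distrib_left mult_ac)
      also have "\<dots> = exp (- ((t - s) *\<^sub>R w)) * (\<Sum>k\<le>n. a k * exp (- (s *\<^sub>R z k)))"
        unfolding split sum_distrib_left by (simp add: mult_ac)
      finally show ?thesis .
    qed
    have "norm (h t - h 0) \<le> t ^ Suc n / fact (Suc n) - 0 ^ Suc n / fact (Suc n)"
    proof (rule differentiable_bound_general[where f' = h' and \<phi>' = "\<lambda>s. s ^ n / fact n"])
      show "continuous_on {0..t} h"
        using h' by (rule continuous_on_vector_derivative)
      show "continuous_on {0..t} (\<lambda>s. s ^ Suc n / fact (Suc n))"
        by (intro continuous_intros) simp
      show "((\<lambda>s. s ^ Suc n / fact (Suc n)) has_vector_derivative s ^ n / fact n) (at s)" for s :: real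
      proof -
        have "((\<lambda>s. s ^ Suc n / fact (Suc n)) has_real_derivative
            real (Suc n) * s ^ n / fact (Suc n)) (at s)"
          by (rule derivative_eq_intros refl | simp)+
        moreover have "real (Suc n) * s ^ n / fact (Suc n) = s ^ n / fact n"
          by (simp add: fact_Suc divide_simps del: of_nat_Suc)
        ultimately show ?thesis
          by (simp add: has_real_derivative_iff_has_vector_derivative)
      qed
      show "norm (h' s) \<le> s ^ n / fact n" if "0 < s" "s < t" for s
      proof -
        have "norm (exp (- ((t - s) *\<^sub>R w))) \<le> 1"
          unfolding w_def using Suc.prems(2)[of "Suc n" "t - s"] that by simp
        with flat[of s] that have "norm (exp (- ((t - s) *\<^sub>R w))) *
            norm (\<Sum>k\<le>n. a k * exp (- (s *\<^sub>R z k))) \<le> 1 * (s ^ n / fact n)"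
          by (intro mult_mono) auto
        then show ?thesis
          by (simp add: h'_eq norm_mult)
      qed
    qed (use t h' in auto)
    moreover have "h 0 = 0"
      by (simp add: h_def vanish del: sum.atMost_Suc)
    moreover have "h t = (\<Sum>k\<le>Suc n. a' k * exp (- (t *\<^sub>R z k)))"
      unfolding h_def sum_distrib_left
      by (rule sum.cong) (use split[of t t] in \<open>auto simp: mult.left_commute\<close>)
    ultimately show ?thesis
      by simp
  qed
  moreover have "norm (\<Sum>k\<le>Suc n. a' k * exp (- (0 *\<^sub>R z k))) \<le> 0 ^ Suc n / fact (Suc n)"
    by (simp add: vanish del: sum.atMost_Suc)
  ultimately have "norm (\<Sum>k\<le>Suc n. a' k * exp (- (t *\<^sub>R z k))) \<le> t ^ Suc n / fact (Suc n)"
    if "0 \<le> t" for t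
    using that by (cases "t = 0") (auto simp del: sum.atMost_Suc)
  moreover have "norm (a' 0) = inverse (\<Prod>j=1..Suc n. norm (z j - z 0))"
    by (simp add: a'_def norm_divide a0 w_def field_simps)
  ultimately show ?case
    by blast
qed

section \<open>From flat exponential sums to the cost\<close>

lemma set_integral_sum:
  fixes f :: "'i \<Rightarrow> 'a \<Rightarrow> 'b::{banach,second_countable_topology}"
  assumes "\<And>i. i \<in> J \<Longrightarrow> set_integrable M A (f i)"
  shows "set_integrable M A (\<lambda>x. \<Sum>i\<in>J. f i x)"
    and "(LINT x:A|M. (\<Sum>i\<in>J. f i x)) = (\<Sum>i\<in>J. LINT x:A|M. f i x)"
  using assms unfolding set_integrable_def set_lebesgue_integral_def scaleR_sum_right
  by (auto intro: Bochner_Integration.integrable_sum Bochner_Integration.integral_sum)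

text \<open>
  As \<open>T < 1\<close>, the \<open>L\<^sup>1\<close> norm is at most the \<open>L\<^sup>2\<close> norm. Using the arithmetic-geometric mean
  inequality \<open>2 \<bar>u\<bar> \<le> C + \<bar>u\<bar>\<^sup>2 / C\<close> with a positive bound \<open>C\<close> of the \<open>L\<^sup>2\<close> norm also yields
  the integrability of \<open>u\<close>.
\<close>

lemma L2_controls_bound_integral:
  fixes u :: "real \<Rightarrow> 'k::real_or_complex"
  assumes u: "u \<in> L2_controls T U" and T: "0 < T" "T < 1" and C: "0 < C" "L2_norm T u \<le> C"
  shows "set_integrable lborel {0<..<T} u"
    and "(LINT s:{0<..<T}|lborel. norm (u s)) \<le> C"
proof -
  have meas: "set_borel_measurable lborel {0<..<T} u"
    and sq: "set_integrable lborel {0<..<T} (\<lambda>s. (norm (u s))\<^sup>2)"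
    using u by (auto simp: L2_controls_def)
  have const: "set_integrable lborel {0<..<T} (\<lambda>_. c)" for c :: real
    using T by (simp add: set_integrable_def)
  have dom: "set_integrable lborel {0<..<T} (\<lambda>s. (C + (norm (u s))\<^sup>2 / C) / 2)"
    using sq const by (intro set_integrable_divide set_integral_add) auto
  have am_gm: "norm (u s) \<le> (C + (norm (u s))\<^sup>2 / C) / 2" for s
  proof -
    have "0 \<le> (norm (u s) - C)\<^sup>2 / C" using C by simp
    also have "\<dots> = (norm (u s))\<^sup>2 / C - 2 * norm (u s) + C"
      using C by (simp add: power2_eq_square field_simps)
    finally show ?thesis by simp
  qed
  show int: "set_integrable lborel {0<..<T} u"
    by (rule set_integrable_bound[OF dom meas]) (use am_gm in \<open>auto intro!: order_trans[OF _ abs_ge_self]\<close>)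
  have "(LINT s:{0<..<T}|lborel. norm (u s)) \<le> (LINT s:{0<..<T}|lborel. (C + (norm (u s))\<^sup>2 / C) / 2)"
    using am_gm by (intro set_integral_mono set_integrable_norm int dom)
  also have "\<dots> = (C * T + (L2_norm T u)\<^sup>2 / C) / 2"
  proof -
    have "0 \<le> (LINT s:{0<..<T}|lborel. (norm (u s))\<^sup>2)"
      unfolding set_lebesgue_integral_def by (rule integral_nonneg_AE) auto
    then show ?thesis
      using sq const T C unfolding L2_norm_def
      by (simp add: set_integral_add set_lebesgue_integral_def[of _ _ "\<lambda>_. C"] mult.commute)
  qed
  also have "\<dots> \<le> C"
  proof -
    have "0 \<le> L2_norm T u"
      unfolding L2_norm_def set_lebesgue_integral_def
      by (intro real_sqrt_ge_zero integral_nonneg_AE) auto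
    then have "(L2_norm T u)\<^sup>2 \<le> C\<^sup>2" using C by simp
    then have "(L2_norm T u)\<^sup>2 / C \<le> C" using C by (simp add: power2_eq_square field_simps)
    moreover have "C * T \<le> C * 1" using T C by (intro mult_left_mono) auto
    ultimately show ?thesis by simp
  qed
  finally show "(LINT s:{0<..<T}|lborel. norm (u s)) \<le> C" .
qed

context control_system
begin

lemma ip_basis: "m \<in> I \<Longrightarrow> n \<in> I \<Longrightarrow> ip (e m) (e n) = (if m = n then 1 else 0)"
  using basis by (auto simp: orthonormal_basis_def)

lemma norm_basis: "m \<in> I \<Longrightarrow> norm (e m) = 1"
proof -
  assume "m \<in> I"
  then have "of_real ((norm (e m))\<^sup>2) = ip (e m) (e m)" "ip (e m) (e m) = of_real 1"
    using ip_basis[of m m] ip_self[of "e m"] by simp_all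
  then have "(norm (e m))\<^sup>2 = 1"
    by (metis of_real_eq_iff)
  then show ?thesis
    using power2_eq_1_iff[of "norm (e m)"] norm_ge_zero[of "e m"] by linarith
qed

lemma semigroup_basis:
  assumes "m \<in> I"
  shows "semigroup_op \<theta> t (e m) = exp (- \<theta> * of_real (lam m * t)) *\<^sub>K e m"
proof -
  have "semigroup_op \<theta> t (e m)
      = (\<Sum>\<^sub>\<infinity>n\<in>{m}. (exp (- \<theta> * of_real (lam n * t)) * ip (e m) (e n)) *\<^sub>K e n)"
    unfolding semigroup_op_def by (rule infsum_cong_neutral) (use assms in \<open>auto simp: ip_basis\<close>)
  then show ?thesis
    using assms by (simp add: ip_basis)
qed

text \<open>
  Duhamel's formula at time \<open>T\<close>, tested against \<open>e k\<close>: each eigenvector turns the semigroup into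
  a scalar exponential, so that null controllability of \<open>e m\<close> becomes a moment problem for \<open>u\<close>.
\<close>

lemma moments_of_null_control:
  assumes drives: "drives_to_zero \<theta> T (e m) u" and T: "0 \<le> T" and mk: "m \<in> I" "k \<in> I"
  shows "(LINT s:{0<..<T}|lborel. exp (- ((T - s) *\<^sub>R (\<theta> * of_real (lam k)))) * b (e k) * u s)
    = (if k = m then - exp (- (T *\<^sub>R (\<theta> * of_real (lam m)))) else 0)"
proof -
  have exp_eq: "exp (- (t *\<^sub>R (\<theta> * of_real r))) = exp (- \<theta> * of_real (r * t))" for t r
    by (simp add: scaleR_conv_of_real mult_ac)
  have e: "e k \<in> D"
    using mk eigenvector by blast
  have "b (c *\<^sub>K e k) = conjugate c * b (e k)" for c
    using b_dual e by (auto simp: dual_domain_def)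
  then have b: "b (semigroup_op (conjugate \<theta>) t (e k)) = exp (- (t *\<^sub>R (\<theta> * of_real (lam k)))) * b (e k)" for t
    using mk by (simp only: semigroup_basis conjugate_exp_conjugate exp_eq)
  obtain y where y: "mild_solution \<theta> T (e m) u y" "y T = 0"
    using drives by (auto simp: drives_to_zero_def)
  have ip_zero: "ip 0 (e k) = 0"
    using ip_add_left[of 0 0 "e k"] by simp
  have "0 = ip (semigroup_op \<theta> T (e m)) (e k) +
      (LINT s:{0<..<T}|lborel. b (semigroup_op (conjugate \<theta>) (T - s) (e k)) * u s)"
  proof -
    have "ip (y T) (e k) = ip (semigroup_op \<theta> T (e m)) (e k) +
        (LINT s:{0<..<T}|lborel. b (semigroup_op (conjugate \<theta>) (T - s) (e k)) * u s)"
      using y(1) e T unfolding mild_solution_def by simp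
    then show ?thesis
      using y(2) ip_zero by simp
  qed
  also have "ip (semigroup_op \<theta> T (e m)) (e k) = (if k = m then exp (- (T *\<^sub>R (\<theta> * of_real (lam m)))) else 0)"
    using mk by (auto simp only: semigroup_basis ip_scale_left ip_basis exp_eq mult_1_right mult_zero_right if_cancel split: if_splits)
  finally show ?thesis
    unfolding b by (simp add: eq_neg_iff_add_eq_0 add.commute split: if_splits)
qed

text \<open>
  Every control that drives \<open>e (idx 0)\<close> to \<open>0\<close> has a prescribed pairing with the reversed
  exponential sum, because all moments but the one of index \<open>idx 0\<close> vanish. If the sum is at most
  \<open>\<epsilon>\<close>, the control must be large enough to make up for it.
\<close>

lemma control_cost_ge_flat_exponential_sum:
  fixes idx :: "nat \<Rightarrow> 'i"
  assumes T: "0 < T" "T < 1"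
    and idx: "inj_on idx {..n}" "idx ` {..n} \<subseteq> I"
    and damp: "\<And>k t. k \<le> n \<Longrightarrow> 0 \<le> t \<Longrightarrow> norm (exp (- (t *\<^sub>R (\<theta> * of_real (lam (idx k)))))) \<le> 1"
    and b: "\<And>k. k \<le> n \<Longrightarrow> b (e (idx k)) \<noteq> 0"
    and flat: "\<And>t. 0 \<le> t \<Longrightarrow> t \<le> T \<Longrightarrow>
      norm (\<Sum>k\<le>n. a k * exp (- (t *\<^sub>R (\<theta> * of_real (lam (idx k)))))) \<le> \<epsilon>"
    and \<epsilon>: "0 < \<epsilon>"
  shows "ereal (norm (a 0) * norm (exp (- (T *\<^sub>R (\<theta> * of_real (lam (idx 0)))))) /
      (norm (b (e (idx 0))) * \<epsilon>)) \<le> control_cost \<theta> U T"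
  unfolding control_cost_def
proof (rule Inf_greatest, clarify)
  fix C :: real
  assume C: "0 < C"
    and all: "\<forall>y0. \<exists>u\<in>L2_controls T U. drives_to_zero \<theta> T y0 u \<and> L2_norm T u \<le> C * norm y0"
  have I: "idx k \<in> I" if "k \<le> n" for k
    using idx that by auto
  obtain u where u: "u \<in> L2_controls T U" "drives_to_zero \<theta> T (e (idx 0)) u" "L2_norm T u \<le> C"
    using all I[of 0] by (metis norm_basis mult_1_right le0)
  define E where "E k s = exp (- ((T - s) *\<^sub>R (\<theta> * of_real (lam (idx k)))))" for k s
  note u_int = L2_controls_bound_integral[OF u(1) T C u(3)]
  have E_int: "set_integrable lborel {0<..<T} (\<lambda>s. E k s * u s)" if k: "k \<le> n" for k
  proof (rule set_integrable_bound[OF u_int(1)])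
    have "set_borel_measurable lborel {0<..<T} u"
      using u by (auto simp: L2_controls_def)
    moreover have "E k \<in> borel_measurable lborel"
      unfolding E_def measurable_lborel2 by (intro borel_measurable_continuous_onI continuous_intros)
    ultimately have "(\<lambda>s. E k s * (indicator {0<..<T} s *\<^sub>R u s)) \<in> borel_measurable lborel"
      unfolding set_borel_measurable_def by (intro borel_measurable_times)
    then show "set_borel_measurable lborel {0<..<T} (\<lambda>s. E k s * u s)"
      by (simp add: set_borel_measurable_def)
    show "AE s in lborel. s \<in> {0<..<T} \<longrightarrow> norm (E k s * u s) \<le> norm (u s)"
      using damp[OF k] by (auto simp: E_def norm_mult intro!: AE_I2 mult_left_le_one_le)
  qed
  have moment: "(LINT s:{0<..<T}|lborel. E k s * u s)
      = (if k = 0 then - exp (- (T *\<^sub>R (\<theta> * of_real (lam (idx 0))))) / b (e (idx 0)) else 0)"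
    if k: "k \<le> n" for k
  proof -
    have "idx k = idx 0 \<longleftrightarrow> k = 0"
      using idx(1) k by (auto simp: inj_on_def)
    moreover have "(LINT s:{0<..<T}|lborel. E k s * b (e (idx k)) * u s)
        = b (e (idx k)) * (LINT s:{0<..<T}|lborel. E k s * u s)"
      by (simp add: mult_ac flip: set_integral_mult_right)
    ultimately show ?thesis
      using moments_of_null_control[OF u(2) _ I[of 0] I[OF k]] T b[OF k]
      by (auto simp: E_def field_simps)
  qed
  define F where "F s = (\<Sum>k\<le>n. a k * E k s)" for s
  have "(LINT s:{0<..<T}|lborel. F s * u s) = (LINT s:{0<..<T}|lborel. (\<Sum>k\<le>n. a k * (E k s * u s)))"
    by (simp add: F_def sum_distrib_right mult.assoc)
  also have "\<dots> = (\<Sum>k\<le>n. a k * (LINT s:{0<..<T}|lborel. E k s * u s))"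
    using E_int by (subst set_integral_sum(2)) auto
  also have "\<dots> = (\<Sum>k\<le>n. if k = 0 then - a 0 * exp (- (T *\<^sub>R (\<theta> * of_real (lam (idx 0))))) / b (e (idx 0)) else 0)"
    by (rule sum.cong) (auto simp: moment)
  finally have "norm (LINT s:{0<..<T}|lborel. F s * u s)
      = norm (a 0) * norm (exp (- (T *\<^sub>R (\<theta> * of_real (lam (idx 0)))))) / norm (b (e (idx 0)))"
    by (simp add: norm_mult norm_divide)
  moreover have "norm (LINT s:{0<..<T}|lborel. F s * u s) \<le> (LINT s:{0<..<T}|lborel. norm (F s * u s))"
    unfolding set_lebesgue_integral_def
    by (rule order_trans[OF integral_norm_bound]) simp
  moreover have "(LINT s:{0<..<T}|lborel. norm (F s * u s)) \<le> (LINT s:{0<..<T}|lborel. \<epsilon> * norm (u s))"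
  proof (rule set_integral_mono)
    have "set_integrable lborel {0<..<T} (\<lambda>s. \<Sum>k\<le>n. a k * (E k s * u s))"
      using E_int by (intro set_integral_sum(1)) auto
    then show "set_integrable lborel {0<..<T} (\<lambda>s. norm (F s * u s))"
      by (intro set_integrable_norm) (simp add: F_def sum_distrib_right mult.assoc)
    show "set_integrable lborel {0<..<T} (\<lambda>s. \<epsilon> * norm (u s))"
      using set_integrable_norm[OF u_int(1)] by simp
    show "norm (F s * u s) \<le> \<epsilon> * norm (u s)" if "s \<in> {0<..<T}" for s
      using flat[of "T - s"] that by (simp add: F_def E_def norm_mult mult_right_mono)
  qed
  moreover have "(LINT s:{0<..<T}|lborel. \<epsilon> * norm (u s)) \<le> \<epsilon> * C"
    using u_int(2) \<epsilon> by simp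
  ultimately have "norm (a 0) * norm (exp (- (T *\<^sub>R (\<theta> * of_real (lam (idx 0)))))) / norm (b (e (idx 0)))
      \<le> \<epsilon> * C"
    by linarith
  then show "ereal (norm (a 0) * norm (exp (- (T *\<^sub>R (\<theta> * of_real (lam (idx 0)))))) /
      (norm (b (e (idx 0))) * \<epsilon>)) \<le> ereal C"
    using \<epsilon> b[of 0] by (simp add: field_simps)
qed

end

section \<open>Growth of the eigenvalues and choice of the number of exponentials\<close>

lemma power_asymptotics_upper_bound:
  assumes "power_asymptotics R \<alpha> \<mu>" and "0 \<le> \<alpha>"
  shows "\<exists>Q>0. \<forall>n\<ge>1. \<mu> n \<le> Q * real n powr \<alpha>"
proof -
  have "(\<lambda>n. real n powr (\<alpha> - 1)) \<in> O(\<lambda>n. real n powr \<alpha>)"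
    by (intro bigoI[of _ 1] eventually_mono[OF eventually_ge_at_top[of 1]]) (auto intro: powr_mono)
  then have "(\<lambda>n. (\<mu> n - R * real n powr \<alpha>) + R * real n powr \<alpha>) \<in> O(\<lambda>n. real n powr \<alpha>)"
    using landau_o.big.trans assms(1) unfolding power_asymptotics_def
    by (intro sum_in_bigo(1)) auto
  then have "\<mu> \<in> O(\<lambda>n. real n powr \<alpha>)"
    by simp
  then obtain c N where c: "0 < c" "\<And>n. N \<le> n \<Longrightarrow> \<bar>\<mu> n\<bar> \<le> c * real n powr \<alpha>"
    by (force elim!: landau_o.bigE simp: eventually_sequentially)
  define Q where "Q = c + (\<Sum>k<N. \<bar>\<mu> k\<bar>)"
  have "\<mu> n \<le> Q * real n powr \<alpha>" if n: "1 \<le> n" for n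
  proof (cases "N \<le> n")
    case True
    have "c * real n powr \<alpha> \<le> Q * real n powr \<alpha>"
      by (intro mult_right_mono) (auto simp: Q_def sum_nonneg)
    then show ?thesis
      using c(2)[OF True] by linarith
  next
    case False
    then have "\<bar>\<mu> n\<bar> \<le> (\<Sum>k<N. \<bar>\<mu> k\<bar>)"
      by (intro member_le_sum) auto
    then have "\<mu> n \<le> Q * 1"
      using c by (simp add: Q_def)
    also have "\<dots> \<le> Q * real n powr \<alpha>"
      using n assms(2) c by (intro mult_left_mono ge_one_powr_ge_zero) (auto simp: Q_def sum_nonneg add_nonneg_nonneg)
    finally show ?thesis .
  qed
  moreover have "0 < Q"
    using c by (simp add: Q_def sum_nonneg add_pos_nonneg)
  ultimately show ?thesis
    by blast
qed

lemma prod_const_times_powr: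
  fixes Q \<alpha> :: real
  shows "(\<Prod>j=1..n. Q * real (Suc j) powr \<alpha>) = Q ^ n * fact (Suc n) powr \<alpha>"
  by (induction n) (simp_all add: powr_mult[symmetric] algebra_simps fact_Suc)

text \<open>
  Write \<open>(n + 1)!\<^sup>\<alpha> = n! (n + 1)\<^sup>\<alpha> n!\<^sup>\<alpha>\<^sup>-\<^sup>1\<close> and use \<open>n + 1 \<le> 2\<^sup>n\<close> and \<open>n! \<le> n\<^sup>n\<close>: the right-hand
  side is at least \<open>(2\<^sup>\<alpha> Q T n\<^sup>\<alpha>\<^sup>-\<^sup>1)\<^sup>-\<^sup>n\<close>. The best choice, up to constants, is the largest \<open>n\<close> for
  which the base \<open>2\<^sup>\<alpha> Q T n\<^sup>\<alpha>\<^sup>-\<^sup>1\<close> is at most \<open>1 / e\<close>; it gives \<open>e\<^sup>n\<close>. Rounding \<open>n\<close> down to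
  an integer costs the \<open>- 1\<close> in the exponent.
\<close>

lemma exists_order_with_exponential_gain:
  fixes Q \<alpha> T :: real
  assumes "0 < Q" "1 < \<alpha>" "0 < T"
  shows "\<exists>n. exp ((exp 1 * 2 powr \<alpha> * Q) powr (- 1 / (\<alpha> - 1)) / T powr (1 / (\<alpha> - 1)) - 1)
    \<le> fact n / (T ^ n * (Q ^ n * fact (Suc n) powr \<alpha>))"
proof -
  \<comment> \<open>\<open>x\<close> is the real solution of \<open>2\<^sup>\<alpha> Q T x\<^sup>\<alpha>\<^sup>-\<^sup>1 = 1 / e\<close>.\<close>
  define x where "x = (exp 1 * 2 powr \<alpha> * Q * T) powr (- 1 / (\<alpha> - 1))"
  define n where "n = nat \<lfloor>x\<rfloor>"
  have x_eq: "x = (exp 1 * 2 powr \<alpha> * Q) powr (- 1 / (\<alpha> - 1)) / T powr (1 / (\<alpha> - 1))"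
    using assms by (simp add: x_def powr_mult powr_minus divide_inverse)
  have x0: "0 \<le> x" by (simp add: x_def)
  have n: "real n \<le> x" "x - 1 \<le> real n"
    using x0 unfolding n_def by linarith+
  have small: "2 powr \<alpha> * (real n powr (\<alpha> - 1) * (Q * T)) \<le> exp (- 1)"
  proof -
    have "real n powr (\<alpha> - 1) \<le> x powr (\<alpha> - 1)"
      using n assms by (intro powr_mono2) auto
    also have "\<dots> = 1 / (exp 1 * 2 powr \<alpha> * Q * T)"
      using assms powr_minus_divide[of "exp 1 * 2 powr \<alpha> * Q * T" 1] unfolding x_def powr_powr by simp
    finally show ?thesis
      using assms by (simp add: field_simps exp_minus)
  qed
  have fact_le: "fact (Suc n) powr \<alpha> \<le> fact n * (2 powr \<alpha> * real n powr (\<alpha> - 1)) ^ n"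
  proof -
    have "fact (Suc n) powr \<alpha> = real (Suc n) powr \<alpha> * (fact n powr (\<alpha> - 1) * fact n)"
      using powr_add[of "fact n :: real" "\<alpha> - 1" 1] by (simp add: fact_Suc powr_mult del: of_nat_Suc)
    also have "\<dots> \<le> (2 ^ n) powr \<alpha> * ((real n ^ n) powr (\<alpha> - 1) * fact n)"
    proof (intro mult_mono powr_mono2)
      show "real (Suc n) \<le> 2 ^ n"
        using less_exp[of n] by (metis Suc_leI of_nat_le_iff of_nat_numeral of_nat_power)
      show "fact n \<le> real n ^ n"
        using fact_le_power[of n, where 'a = real] by simp
    qed (use assms in auto)
    also have "\<dots> = fact n * (2 powr \<alpha> * real n powr (\<alpha> - 1)) ^ n"
    proof -
      have "(y ^ k) powr p = (y powr p) ^ k" if "0 \<le> y" for y p :: real and k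
        using that by (induction k) (simp_all add: powr_mult)
      then show ?thesis
        by (simp add: power_mult_distrib mult_ac)
    qed
    finally show ?thesis .
  qed
  have "T ^ n * (Q ^ n * fact (Suc n) powr \<alpha>)
      \<le> T ^ n * (Q ^ n * (fact n * (2 powr \<alpha> * real n powr (\<alpha> - 1)) ^ n))"
    using fact_le assms by (intro mult_left_mono) auto
  also have "\<dots> = fact n * (2 powr \<alpha> * (real n powr (\<alpha> - 1) * (Q * T))) ^ n"
    by (simp add: power_mult_distrib mult_ac)
  also have "\<dots> \<le> fact n * exp (- 1) ^ n"
    using small assms by (intro mult_left_mono power_mono) auto
  finally have "T ^ n * (Q ^ n * fact (Suc n) powr \<alpha>) * exp (real n) \<le> fact n"
    by (simp add: exp_of_nat_mult[symmetric] exp_minus field_simps)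
  moreover have "0 < T ^ n * (Q ^ n * fact (Suc n) powr \<alpha>)"
    using assms by simp
  ultimately have "exp (real n) \<le> fact n / (T ^ n * (Q ^ n * fact (Suc n) powr \<alpha>))"
    by (simp add: pos_le_divide_eq mult.commute)
  moreover have "exp (x - 1) \<le> exp (real n)"
    using n by simp
  ultimately show ?thesis
    unfolding x_eq by (intro exI[of _ n]) linarith
qed

section \<open>The lower bound for the cost of the control\<close>

theorem theorem1p3:
  fixes scale :: "'k::real_or_complex \<Rightarrow> 'h::banach \<Rightarrow> 'h"
    and ip :: "'h \<Rightarrow> 'h \<Rightarrow> 'k"
    and D :: "'h set" and A :: "'h \<Rightarrow> 'h"
    and I :: "int set" and lam :: "int \<Rightarrow> real" and e :: "int \<Rightarrow> 'h"
    and b :: "'h \<Rightarrow> 'k"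
    and U :: "'k set" and \<theta> :: 'k
    and R \<alpha> :: real
  assumes system: "control_system scale ip D A I lam e b"
    and U: "U = \<real> \<or> U = UNIV"
    and b: "asymp_one I (\<lambda>k. b (e k))"
    and R: "0 < R"
    and regular: "regular_family I lam"
    and increasing: "strict_mono_on I lam"
    and situation:
      "(to_complex \<theta> = \<i> \<and> I = {1..} \<and> hilbert_space.positive ip D A \<and>
          (\<forall>n\<in>I. 0 < lam n) \<and> 2 \<le> \<alpha> \<and>
          power_asymptotics R \<alpha> (\<lambda>n. lam (int n))) \<or>
       (\<theta> = 1 \<and> I = {1..} \<and> hilbert_space.positive ip D A \<and>
          (\<forall>n\<in>I. 0 < lam n) \<and> 1 < \<alpha> \<and>
          power_asymptotics R \<alpha> (\<lambda>n. lam (int n))) \<or>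
       (to_complex \<theta> = \<i> \<and> I = {n. n \<noteq> 0} \<and>
          (\<forall>n\<in>I. sgn (lam n) = of_int (sgn n)) \<and> 1 < \<alpha> \<and>
          power_asymptotics R \<alpha> (\<lambda>n. lam (int n)) \<and>
          power_asymptotics R \<alpha> (\<lambda>n. - lam (- int n)))"
  shows "\<exists>C>0. \<exists>c>0. \<forall>T\<in>{0<..<1}.
           ereal (c * exp (C / T powr (1 / (\<alpha> - 1))))
             \<le> control_system.control_cost scale ip D I lam e b \<theta> U T"
proof -
  interpret control_system scale ip D A I lam e b
    by (rule system)
  have I: "int (Suc k) \<in> I" for k
    using situation by auto
  have pos: "0 < lam (int (Suc k))" for k
    using situation I[of k] by (auto simp: sgn_if split: if_splits)
  have \<alpha>: "1 < \<alpha>" and asymp: "power_asymptotics R \<alpha> (\<lambda>n. lam (int n))"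
    using situation by auto
  have \<theta>: "0 \<le> Re (to_complex \<theta>)" "Re (to_complex \<theta>) \<le> 1" "norm \<theta> = 1"
    using situation norm_to_complex[of \<theta>] by (auto simp: to_complex_one)
  obtain Q where Q: "0 < Q" "\<And>n. 1 \<le> n \<Longrightarrow> lam (int n) \<le> Q * real n powr \<alpha>"
    using power_asymptotics_upper_bound[OF asymp] \<alpha> by auto
  obtain m M where mM: "0 < m" "0 < M" "\<And>k. k \<in> I \<Longrightarrow> m \<le> norm (b (e k)) \<and> norm (b (e k)) \<le> M"
    using b by (auto simp: asymp_one_def)
  \<comment> \<open>The tested eigenvalues are \<open>lam 1 < lam 2 < \<dots>\<close>, all positive; the shift makes the first index \<open>0\<close>.\<close>
  define idx where "idx k = int (Suc k)" for k
  define z where "z k = \<theta> * of_real (lam (idx k))" for k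
  have lam_less: "lam (idx i) < lam (idx j)" if "i < j" for i j
    using increasing I that by (auto simp: strict_mono_on_def idx_def)
  have norm_z: "norm (z j - z i) = \<bar>lam (idx j) - lam (idx i)\<bar>" for i j
    unfolding z_def right_diff_distrib[symmetric] of_real_diff[symmetric] norm_mult \<theta> norm_of_real
    by simp
  have inj_z: "inj z"
  proof (rule injI)
    fix i j assume "z i = z j"
    then have "lam (idx i) = lam (idx j)" using norm_z[of i j] by simp
    then show "i = j" using lam_less by (metis less_irrefl nat_neq_iff)
  qed
  have norm_exp_z: "norm (exp (- (t *\<^sub>R z k))) = exp (- (t * (Re (to_complex \<theta>) * lam (idx k))))" for t k
    by (simp add: norm_exp_to_complex to_complex_minus to_complex_scaleR z_def to_complex_mult
        to_complex_of_real)
  have damp: "norm (exp (- (t *\<^sub>R z k))) \<le> 1" if "0 \<le> t" for t k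
    using that \<theta> pos[of k] by (simp add: norm_exp_z idx_def)
  define C where "C = (exp 1 * 2 powr \<alpha> * Q) powr (- 1 / (\<alpha> - 1))"
  \<comment> \<open>The first factor bounds \<open>\<bar>exp(- \<theta> \<lambda>\<^sub>1 T) / b\<^sub>1\<bar>\<close> from below for \<open>T < 1\<close>; the second is the loss from rounding.\<close>
  define c where "c = exp (- lam (idx 0)) / M * exp (- 1)"
  have "ereal (c * exp (C / T powr (1 / (\<alpha> - 1)))) \<le> control_cost \<theta> U T"
    if T: "0 < T" "T < 1" for T
  proof -
    obtain n where n: "exp (C / T powr (1 / (\<alpha> - 1)) - 1)
        \<le> fact n / (T ^ n * (Q ^ n * fact (Suc n) powr \<alpha>))"
      using exists_order_with_exponential_gain[OF Q(1) \<alpha> T(1)] by (auto simp: C_def)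
    define P where "P = (\<Prod>j=1..n. norm (z j - z 0))"
    obtain a where a0: "norm (a 0) = inverse P"
      and flat: "\<And>t. 0 \<le> t \<Longrightarrow> norm (\<Sum>k\<le>n. a k * exp (- (t *\<^sub>R z k))) \<le> t ^ n / fact n"
      using exists_flat_exponential_sum[of z n] inj_z damp by (auto simp: P_def intro: inj_on_subset)
    have flat_T: "norm (\<Sum>k\<le>n. a k * exp (- (t *\<^sub>R z k))) \<le> T ^ n / fact n" if "0 \<le> t" "t \<le> T" for t
      using that by (intro order_trans[OF flat] divide_right_mono power_mono) auto
    have cost: "ereal (norm (a 0) * norm (exp (- (T *\<^sub>R z 0))) / (norm (b (e (idx 0))) * (T ^ n / fact n)))
        \<le> control_cost \<theta> U T"
      unfolding z_def
    proof (rule control_cost_ge_flat_exponential_sum[where n = n])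
      show "inj_on idx {..n}" "idx ` {..n} \<subseteq> I"
        using I by (auto simp: idx_def inj_on_def)
      show "b (e (idx k)) \<noteq> 0" for k
        using mM(1) mM(3)[OF I[of k]] by (auto simp: idx_def)
      show "norm (exp (- (t *\<^sub>R (\<theta> * of_real (lam (idx k)))))) \<le> 1" if "0 \<le> t" for k t
        using damp[OF that] unfolding z_def .
      show "norm (\<Sum>k\<le>n. a k * exp (- (t *\<^sub>R (\<theta> * of_real (lam (idx k)))))) \<le> T ^ n / fact n"
        if "0 \<le> t" "t \<le> T" for t
        using flat_T[OF that] unfolding z_def .
    qed (use T in auto)
    have P_le: "P \<le> Q ^ n * fact (Suc n) powr \<alpha>"
      unfolding P_def prod_const_times_powr[symmetric]
    proof (intro prod_mono conjI norm_ge_zero)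
      fix j assume "j \<in> {1..n}"
      then show "norm (z j - z 0) \<le> Q * real (Suc j) powr \<alpha>"
        using lam_less[of 0 j] pos[of 0] Q(2)[of "Suc j"] by (simp add: norm_z idx_def)
    qed
    have P_pos: "0 < P"
      unfolding P_def by (intro prod_pos) (use inj_z in \<open>auto simp: inj_def\<close>)
    have "exp (- lam (idx 0)) \<le> norm (exp (- (T *\<^sub>R z 0)))"
    proof -
      have "T * (Re (to_complex \<theta>) * lam (idx 0)) \<le> 1 * (1 * lam (idx 0))"
        using T \<theta> pos[of 0] by (intro mult_mono) (auto simp: idx_def)
      then show ?thesis by (simp add: norm_exp_z)
    qed
    moreover have "0 < norm (b (e (idx 0)))" "norm (b (e (idx 0))) \<le> M"
      using mM(1) mM(3)[of "idx 0"] I[of 0] by (auto simp: idx_def)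
    ultimately have first: "exp (- lam (idx 0)) / M \<le> norm (exp (- (T *\<^sub>R z 0))) / norm (b (e (idx 0)))"
      by (intro frac_le) auto
    have "exp (C / T powr (1 / (\<alpha> - 1)) - 1) \<le> fact n / (T ^ n * P)"
      using n by (rule order_trans) (use P_le P_pos T in \<open>auto intro!: divide_left_mono mult_left_mono\<close>)
    then have "exp (- lam (idx 0)) / M * exp (C / T powr (1 / (\<alpha> - 1)) - 1)
        \<le> norm (exp (- (T *\<^sub>R z 0))) / norm (b (e (idx 0))) * (fact n / (T ^ n * P))"
      using first mM(2) by (intro mult_mono) auto
    also have "\<dots> = norm (a 0) * norm (exp (- (T *\<^sub>R z 0))) / (norm (b (e (idx 0))) * (T ^ n / fact n))"
      by (simp add: a0 field_simps)
    finally have "c * exp (C / T powr (1 / (\<alpha> - 1)))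
        \<le> norm (a 0) * norm (exp (- (T *\<^sub>R z 0))) / (norm (b (e (idx 0))) * (T ^ n / fact n))"
      by (simp add: c_def exp_diff exp_minus field_simps)
    with cost show ?thesis
      by (meson ereal_less_eq(3) order_trans)
  qed
  moreover have "0 < C" "0 < c"
    using Q mM by (auto simp: C_def c_def)
  ultimately show ?thesis
    by (metis greaterThanLessThan_iff)
qed

end
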